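(* The relation $\sim$ on $\Sigma$, defined for $g,g'\in\Sigma$ by $g\sim g'$ if and only if $g$ is connected to $g'$, is an equivalence relation on $\Sigma$.
   Context: $\mathbb{N}$ is the set of non-negative integers. Setting. Let $\mathcal{R}$ be a commutative ring, $I$ an arbitrary index set, and $\mathcal{M}_I(\mathcal{R})$ the $\mathcal{R}$-algebra of $I\times I$ matrices over $\mathcal{R}$ with only finitely many non-zero entries, with the usual product (juxtaposition). Let $\psi,\phi$ be two commuting $\mathcal{R}$-algebra automorphisms of it and put $x\star y:=\psi(x)\phi(y)$. Let $(G,+)$ be an abelian group with neutral element $0$ and let $\alpha,\beta$ be two commuting automorphisms of $G$. Suppose $\mathcal{M}_I(\mathcal{R})=\bigoplus_{g\in G}\mathcal{M}_I(\mathcal{R})_g$ is a direct sum of $\mathcal{R}$-submodules such that, for all $g,g'\in G$, $\psi(\mathcal{M}_I(\mathcal{R})_g)\subseteq\mathcal{M}_I(\mathcal{R})_{\alpha(g)}$, $\phi(\mathcal{M}_I(\mathcal{R})_g)\subseteq\mathcal{M}_I(\mathcal{R})_{\beta(g)}$ and $\mathcal{M}_I(\mathcal{R})_g\star\mathcal{M}_I(\mathcal{R})_{g'}\subseteq\mathcal{M}_I(\mathcal{R})_{\alpha(g)+\beta(g')}$. The support is $\Sigma:=\{g\in G\setminus\{0\}\mid \mathcal{M}_I(\mathcal{R})_g\neq 0\}$. It is assumed symmetric: $g\in\Sigma$ implies $-g\in\Sigma$. Connections. For $g,g'\in\Sigma$, a connection from $g$ to $g'$ is a finite sequence $g_1,\dots,g_k$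 of elements of $\Sigma$ ($k\ge 1$), written $\{g_1,\dots,g_k\}$, such that: if $k=1$, then $g_1\in\{\alpha^i\circ\beta^j(g)\mid i,j\in\mathbb{N}\}\cap\{\pm\alpha^m\circ\beta^n(g')\mid m,n\in\mathbb{N}\}$; if $k\ge 2$, then (1) $g_1\in\{\alpha^i\circ\beta^j(g)\mid i,j\in\mathbb{N}\}$, (2) for every $2\le l\le k-1$ the element $\alpha^{l-1}(g_1)+\sum_{t=2}^{l}\alpha^{l-t}\circ\beta(g_t)$ belongs to $\Sigma$, and (3) $\alpha^{k-1}(g_1)+\sum_{t=2}^{k}\alpha^{k-t}\circ\beta(g_t)\in\{\pm\alpha^m\circ\beta^n(g')\mid m,n\in\mathbb{N}\}$. We say $g$ is connected to $g'$ if such a connection exists. *)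

theory Defs
  imports "HOL-Library.Function_Algebras" "HOL-Library.Groups_Big_Fun"
begin

text \<open>
  Addition, subtraction and zero of matrices are the pointwise operations on functions from
  Function_Algebras.  The pointwise product provided there is not the matrix product, which is
  \<open>mat_mult\<close> below.

  The index set \<open>I\<close> is a set rather than a type, so that it may be empty.  The class \<open>comm_ring\<close>
  requires neither a unit nor that the ring be non-trivial.
\<close>

type_synonym ('i, 'r) mat = "'i \<Rightarrow> 'i \<Rightarrow> 'r"

definition fin_mats :: "'i set \<Rightarrow> ('i, 'r::comm_ring) mat set" where
  "fin_mats I = {A. {(i, j). A i j \<noteq> 0} \<subseteq> I \<times> I \<and> finite {(i, j). A i j \<noteq> 0}}"

definition mat_scale :: "'r::comm_ring \<Rightarrow> ('i, 'r) mat \<Rightarrow> ('i, 'r) mat" where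
  "mat_scale r A = (\<lambda>i j. r * A i j)"

text \<open>
  \<open>Sum_any\<close> adds up the finitely many non-zero terms; for \<open>A\<close> and \<open>B\<close> in \<open>fin_mats I\<close> only
  finitely many \<open>k\<close> contribute.
\<close>

definition mat_mult :: "('i, 'r::comm_ring) mat \<Rightarrow> ('i, 'r) mat \<Rightarrow> ('i, 'r) mat" where
  "mat_mult A B = (\<lambda>i j. Sum_any (\<lambda>k. A i k * B k j))"

text \<open>The algebra need not have a unit, so none is required to be preserved.\<close>

definition mat_alg_automorphism ::
  "'i set \<Rightarrow> (('i, 'r::comm_ring) mat \<Rightarrow> ('i, 'r) mat) \<Rightarrow> bool" where
  "mat_alg_automorphism I f \<longleftrightarrow>
     bij_betw f (fin_mats I) (fin_mats I) \<and>
     (\<forall>A\<in>fin_mats I. \<forall>B\<in>fin_mats I. f (A + B) = f A + f B) \<and>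
     (\<forall>r. \<forall>A\<in>fin_mats I. f (mat_scale r A) = mat_scale r (f A)) \<and>
     (\<forall>A\<in>fin_mats I. \<forall>B\<in>fin_mats I. f (mat_mult A B) = mat_mult (f A) (f B))"

definition twisted_mult ::
  "(('i, 'r::comm_ring) mat \<Rightarrow> ('i, 'r) mat) \<Rightarrow> (('i, 'r) mat \<Rightarrow> ('i, 'r) mat) \<Rightarrow>
   ('i, 'r) mat \<Rightarrow> ('i, 'r) mat \<Rightarrow> ('i, 'r) mat" where
  "twisted_mult \<psi> \<phi> x y = mat_mult (\<psi> x) (\<phi> y)"

text \<open>Closure under subtraction is stated separately because \<open>'r\<close> need not contain \<open>-1\<close>.\<close>

definition mat_submodule :: "'i set \<Rightarrow> ('i, 'r::comm_ring) mat set \<Rightarrow> bool" where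
  "mat_submodule I N \<longleftrightarrow>
     N \<subseteq> fin_mats I \<and> 0 \<in> N \<and>
     (\<forall>A\<in>N. \<forall>B\<in>N. A + B \<in> N) \<and>
     (\<forall>A\<in>N. \<forall>B\<in>N. A - B \<in> N) \<and>
     (\<forall>r. \<forall>A\<in>N. mat_scale r A \<in> N)"

definition mat_direct_sum ::
  "'i set \<Rightarrow> ('g \<Rightarrow> ('i, 'r::comm_ring) mat set) \<Rightarrow> bool" where
  "mat_direct_sum I Mg \<longleftrightarrow>
     (\<forall>g. mat_submodule I (Mg g)) \<and>
     (\<forall>A\<in>fin_mats I. \<exists>!c. (\<forall>g. c g \<in> Mg g) \<and> finite {g. c g \<noteq> 0} \<and> A = Sum_any c)"

definition group_automorphism :: "('g::ab_group_add \<Rightarrow> 'g) \<Rightarrow> bool" where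
  "group_automorphism f \<longleftrightarrow> bij f \<and> (\<forall>x y. f (x + y) = f x + f y)"

definition grading_support ::
  "('g::ab_group_add \<Rightarrow> ('i, 'r::comm_ring) mat set) \<Rightarrow> 'g set" where
  "grading_support Mg = {g. g \<noteq> 0 \<and> Mg g \<noteq> {0}}"

definition orbit :: "('g \<Rightarrow> 'g) \<Rightarrow> ('g \<Rightarrow> 'g) \<Rightarrow> 'g \<Rightarrow> 'g set" where
  "orbit \<alpha> \<beta> g = {(\<alpha> ^^ i) ((\<beta> ^^ j) g) | i j. True}"

definition pm_orbit :: "('g::ab_group_add \<Rightarrow> 'g) \<Rightarrow> ('g \<Rightarrow> 'g) \<Rightarrow> 'g \<Rightarrow> 'g set" where
  "pm_orbit \<alpha> \<beta> g = orbit \<alpha> \<beta> g \<union> uminus ` orbit \<alpha> \<beta> g"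

text \<open>
  A sequence \<open>g\<^sub>1, \<dots>, g\<^sub>k\<close> is a list \<open>gs\<close> of length \<open>k\<close>, and \<open>g\<^sub>t\<close> is \<open>gs ! (t - 1)\<close>.
\<close>

definition partial_term ::
  "('g::ab_group_add \<Rightarrow> 'g) \<Rightarrow> ('g \<Rightarrow> 'g) \<Rightarrow> 'g list \<Rightarrow> nat \<Rightarrow> 'g" where
  "partial_term \<alpha> \<beta> gs l =
     (\<alpha> ^^ (l - 1)) (gs ! 0) + (\<Sum>t = 2..l. (\<alpha> ^^ (l - t)) (\<beta> (gs ! (t - 1))))"

definition is_connection ::
  "('g::ab_group_add \<Rightarrow> 'g) \<Rightarrow> ('g \<Rightarrow> 'g) \<Rightarrow> 'g set \<Rightarrow> 'g list \<Rightarrow> 'g \<Rightarrow> 'g \<Rightarrow> bool" where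
  "is_connection \<alpha> \<beta> S gs g g' \<longleftrightarrow>
     gs \<noteq> [] \<and> set gs \<subseteq> S \<and>
     (if length gs = 1
      then gs ! 0 \<in> orbit \<alpha> \<beta> g \<inter> pm_orbit \<alpha> \<beta> g'
      else gs ! 0 \<in> orbit \<alpha> \<beta> g \<and>
           (\<forall>l. 2 \<le> l \<and> l \<le> length gs - 1 \<longrightarrow> partial_term \<alpha> \<beta> gs l \<in> S) \<and>
           partial_term \<alpha> \<beta> gs (length gs) \<in> pm_orbit \<alpha> \<beta> g')"

definition connected_to ::
  "('g::ab_group_add \<Rightarrow> 'g) \<Rightarrow> ('g \<Rightarrow> 'g) \<Rightarrow> 'g set \<Rightarrow> 'g \<Rightarrow> 'g \<Rightarrow> bool" where
  "connected_to \<alpha> \<beta> S g g' \<longleftrightarrow> (\<exists>gs. is_connection \<alpha> \<beta> S gs g g')"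

end

theory Submission
  imports Defs
begin

text \<open>
  The partial terms of a sequence \<open>g\<^sub>1, \<dots>, g\<^sub>k\<close> obey the recursion \<open>p\<^sub>1 = g\<^sub>1\<close>,
  \<open>p\<^sub>l\<^sub>+\<^sub>1 = \<alpha> p\<^sub>l + \<beta> g\<^sub>l\<^sub>+\<^sub>1\<close>.  A connection from \<open>g\<close> to \<open>g'\<close> is therefore a walk inside the
  support \<open>\<Sigma>\<close>, with steps \<open>p \<mapsto> \<alpha> p + \<beta> h\<close> for \<open>h \<in> \<Sigma>\<close>, that starts in the orbit of \<open>g\<close> and ends in
  plus or minus the orbit of \<open>g'\<close> (\<open>connected_to_iff_walk\<close>).

  The grading serves to show that \<open>\<alpha>\<close> and \<open>\<beta>\<close> map \<open>\<Sigma>\<close> into itself: \<open>\<psi>\<close> and \<open>\<phi>\<close> are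
  injective, so they send a non-zero homogeneous component to a non-zero one
  (\<open>grading_support_closed\<close>).  The rest is about a set \<open>S\<close> that is stable under the commuting
  additive maps \<open>\<alpha>\<close>, \<open>\<beta>\<close> and \<open>-\<close>.  Each of these three maps carries steps to steps
  (\<open>walk_image\<close>), which is the key to both non-trivial properties.

  Symmetry: a step \<open>b \<mapsto> c = \<alpha> b + \<beta> h\<close> can be undone up to a power of \<open>\<alpha>\<close>, because
  \<open>\<alpha> c + \<beta> (- \<alpha> h) = \<alpha> (\<alpha> b)\<close>.  A walk from \<open>a\<close> to \<open>b\<close> is thus followed by one from \<open>b\<close> back
  to some \<open>\<alpha>\<^sup>n a\<close> (\<open>walk_reverse\<close>), which lies in the same orbit as \<open>a\<close>.

  Transitivity: let one walk end at \<open>b = \<plusminus> \<alpha>\<^sup>m \<beta>\<^sup>n g'\<close> and another start at \<open>a' = \<alpha>\<^sup>i \<beta>\<^sup>j g'\<close>.  Then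
  the image of the first under \<open>\<alpha>\<^sup>i \<beta>\<^sup>j\<close> ends at the point \<open>\<alpha>\<^sup>i \<beta>\<^sup>j b = \<plusminus> \<alpha>\<^sup>m \<beta>\<^sup>n a'\<close>, where the image of
  the second under \<open>\<plusminus> \<alpha>\<^sup>m \<beta>\<^sup>n\<close> starts, and the two images can be joined.
\<close>

section \<open>Walks in a set stable under two commuting maps\<close>

locale commuting_maps =
  fixes \<alpha> \<beta> :: "'g::ab_group_add \<Rightarrow> 'g" and S :: "'g set"
  assumes alpha_add: "\<alpha> (x + y) = \<alpha> x + \<alpha> y"
    and beta_add: "\<beta> (x + y) = \<beta> x + \<beta> y"
    and commute: "\<alpha> (\<beta> x) = \<beta> (\<alpha> x)"
    and alpha_closed: "x \<in> S \<Longrightarrow> \<alpha> x \<in> S"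
    and beta_closed: "x \<in> S \<Longrightarrow> \<beta> x \<in> S"
    and minus_closed: "x \<in> S \<Longrightarrow> - x \<in> S"
begin

lemma alpha_zero: "\<alpha> 0 = 0"
  using alpha_add[of 0 0] by simp

lemma beta_zero: "\<beta> 0 = 0"
  using beta_add[of 0 0] by simp

lemma alpha_minus: "\<alpha> (- x) = - \<alpha> x"
  using alpha_add[of "- x" x] by (simp add: alpha_zero eq_neg_iff_add_eq_0)

lemma beta_minus: "\<beta> (- x) = - \<beta> x"
  using beta_add[of "- x" x] by (simp add: beta_zero eq_neg_iff_add_eq_0)

definition step :: "'g \<Rightarrow> 'g \<Rightarrow> bool" where
  "step p q \<longleftrightarrow> p \<in> S \<and> q \<in> S \<and> (\<exists>h\<in>S. q = \<alpha> p + \<beta> h)"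

abbreviation walk :: "'g \<Rightarrow> 'g \<Rightarrow> bool" where
  "walk \<equiv> step\<^sup>*\<^sup>*"

text \<open>
  Maps of this kind carry walks to walks.  They form a monoid, which contains \<open>\<alpha>\<close>, \<open>\<beta>\<close> and \<open>-\<close> and
  hence every \<open>\<plusminus> \<alpha>\<^sup>i \<beta>\<^sup>j\<close>.
\<close>
definition symmetry :: "('g \<Rightarrow> 'g) \<Rightarrow> bool" where
  "symmetry f \<longleftrightarrow> f ` S \<subseteq> S \<and> (\<forall>x y. f (x + y) = f x + f y) \<and>
     (\<forall>x. f (\<alpha> x) = \<alpha> (f x)) \<and> (\<forall>x. f (\<beta> x) = \<beta> (f x))"

lemma symmetry_alpha: "symmetry \<alpha>"
  unfolding symmetry_def using alpha_closed by (auto simp: alpha_add commute)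

lemma symmetry_beta: "symmetry \<beta>"
  unfolding symmetry_def using beta_closed by (auto simp: beta_add commute)

lemma symmetry_minus: "symmetry uminus"
  unfolding symmetry_def using minus_closed by (auto simp: alpha_minus beta_minus)

lemma symmetry_comp: "symmetry f \<Longrightarrow> symmetry g \<Longrightarrow> symmetry (\<lambda>x. f (g x))"
  unfolding symmetry_def by (auto simp: image_subset_iff)

lemma symmetry_funpow: "symmetry f \<Longrightarrow> symmetry (f ^^ n)"
proof (induction n)
  case 0
  then show ?case by (simp add: symmetry_def)
next
  case (Suc n)
  then show ?case using symmetry_comp[of f "f ^^ n"] by (simp add: comp_def)
qed

lemma walk_image:
  assumes "symmetry f" "walk a b"
  shows "walk (f a) (f b)"
  using assms(2)
proof (induction rule: rtranclp_induct)
  case base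
  then show ?case by simp
next
  case (step b c)
  have "step (f b) (f c)"
    using step.hyps(2) assms(1) unfolding step_def symmetry_def by (fastforce simp: image_subset_iff)
  with step.IH show ?case by simp
qed

text \<open>
  Undoing one step doubles the \<open>\<alpha>\<close>, so the way back does not return to \<open>a\<close> itself but to a point
  further along its \<open>\<alpha>\<close>-orbit; the rest of the way back has to be shifted accordingly.
\<close>
lemma walk_reverse:
  assumes "walk a b"
  obtains n where "walk b ((\<alpha> ^^ n) a)"
proof -
  from assms have "\<exists>n. walk b ((\<alpha> ^^ n) a)"
  proof (induction rule: rtranclp_induct)
    case base
    have "walk a ((\<alpha> ^^ 0) a)" by simp
    then show ?case by blast
  next
    case (step b c)
    then obtain n where n: "walk b ((\<alpha> ^^ n) a)" by blast
    obtain h where h: "h \<in> S" "c = \<alpha> b + \<beta> h" and bc: "b \<in> S" "c \<in> S"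
      using step.hyps(2) by (auto simp: step_def)
    have "\<alpha> (\<alpha> b) = \<alpha> c + \<beta> (- \<alpha> h)"
      by (simp add: h(2) alpha_add beta_minus commute)
    then have "step c (\<alpha> (\<alpha> b))"
      unfolding step_def using h(1) bc alpha_closed minus_closed by blast
    moreover have "walk (\<alpha> (\<alpha> b)) (\<alpha> (\<alpha> ((\<alpha> ^^ n) a)))"
      by (intro walk_image[OF symmetry_alpha] n)
    ultimately have "walk c ((\<alpha> ^^ Suc (Suc n)) a)"
      by simp
    then show ?case by blast
  qed
  with that show thesis by blast
qed

section \<open>Orbits and connections\<close>

abbreviation twist :: "nat \<Rightarrow> nat \<Rightarrow> 'g \<Rightarrow> 'g" where
  "twist i j x \<equiv> (\<alpha> ^^ i) ((\<beta> ^^ j) x)"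

lemma symmetry_twist: "symmetry (twist i j)"
  by (rule symmetry_comp[OF symmetry_funpow[OF symmetry_alpha] symmetry_funpow[OF symmetry_beta]])

lemma symmetry_commute_twist:
  assumes "symmetry f"
  shows "f (twist i j x) = twist i j (f x)"
proof -
  have "f ((\<alpha> ^^ i) y) = (\<alpha> ^^ i) (f y)" for y
    using assms by (induction i) (auto simp: symmetry_def)
  moreover have "f ((\<beta> ^^ j) y) = (\<beta> ^^ j) (f y)" for y
    using assms by (induction j) (auto simp: symmetry_def)
  ultimately show ?thesis by simp
qed

lemma twist_minus: "twist i j (- x) = - twist i j x"
  using symmetry_commute_twist[OF symmetry_minus] by simp

lemma twist_twist: "twist i j (twist m n x) = twist (i + m) (j + n) x"
proof -
  have "(\<beta> ^^ j) (twist m n x) = (\<alpha> ^^ m) ((\<beta> ^^ j) ((\<beta> ^^ n) x))"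
    using symmetry_commute_twist[OF symmetry_funpow[OF symmetry_beta], of j m 0 "(\<beta> ^^ n) x"]
    by simp
  then show ?thesis
    by (simp add: funpow_add)
qed

lemma orbit_iff: "x \<in> orbit \<alpha> \<beta> g \<longleftrightarrow> (\<exists>i j. x = twist i j g)"
  by (auto simp: orbit_def)

lemma pm_orbit_iff: "x \<in> pm_orbit \<alpha> \<beta> g \<longleftrightarrow> (\<exists>i j. x = twist i j g \<or> x = - twist i j g)"
  unfolding pm_orbit_def orbit_def by blast

lemma orbit_twist: "x \<in> orbit \<alpha> \<beta> g \<Longrightarrow> twist i j x \<in> orbit \<alpha> \<beta> g"
  unfolding orbit_iff by (elim exE, hypsubst, subst twist_twist) (intro exI, rule refl)

lemma pm_orbit_iff_orbit: "x \<in> pm_orbit \<alpha> \<beta> g \<longleftrightarrow> x \<in> orbit \<alpha> \<beta> g \<or> - x \<in> orbit \<alpha> \<beta> g"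
proof -
  have "x \<in> uminus ` A \<longleftrightarrow> - x \<in> A" for A :: "'g set"
    by (metis imageE imageI minus_minus)
  then show ?thesis by (simp add: pm_orbit_def)
qed

lemma pm_orbit_twist: "x \<in> pm_orbit \<alpha> \<beta> g \<Longrightarrow> twist i j x \<in> pm_orbit \<alpha> \<beta> g"
  unfolding pm_orbit_iff_orbit twist_minus[symmetric] using orbit_twist by blast

lemma pm_orbit_minus: "x \<in> pm_orbit \<alpha> \<beta> g \<Longrightarrow> - x \<in> pm_orbit \<alpha> \<beta> g"
  by (auto simp: pm_orbit_iff_orbit)

lemma pm_orbit_subset:
  assumes "g \<in> S"
  shows "pm_orbit \<alpha> \<beta> g \<subseteq> S"
proof -
  have "twist i j g \<in> S" for i j
    using symmetry_twist[of i j] assms unfolding symmetry_def by blast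
  then show ?thesis using minus_closed by (auto simp: pm_orbit_iff)
qed

lemma partial_term_one: "partial_term \<alpha> \<beta> gs (Suc 0) = gs ! 0"
  by (simp add: partial_term_def)

lemma partial_term_Suc:
  assumes "1 \<le> l"
  shows "partial_term \<alpha> \<beta> gs (Suc l) = \<alpha> (partial_term \<alpha> \<beta> gs l) + \<beta> (gs ! l)"
proof -
  have "\<alpha> (\<Sum>t = 2..l. (\<alpha> ^^ (l - t)) (\<beta> (gs ! (t - 1)))) =
        (\<Sum>t = 2..l. \<alpha> ((\<alpha> ^^ (l - t)) (\<beta> (gs ! (t - 1)))))"
    by (simp add: sum_comp_morphism[of \<alpha>, OF alpha_zero alpha_add, symmetric] comp_def)
  also have "\<dots> = (\<Sum>t = 2..l. (\<alpha> ^^ (Suc l - t)) (\<beta> (gs ! (t - 1))))"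
    by (intro sum.cong) (auto simp: Suc_diff_le)
  finally have sum: "\<alpha> (\<Sum>t = 2..l. (\<alpha> ^^ (l - t)) (\<beta> (gs ! (t - 1)))) =
    (\<Sum>t = 2..l. (\<alpha> ^^ (Suc l - t)) (\<beta> (gs ! (t - 1))))" .
  have "\<alpha> ((\<alpha> ^^ (l - 1)) (gs ! 0)) = (\<alpha> ^^ l) (gs ! 0)"
    using assms by (cases l) auto
  then show ?thesis
    using assms sum by (simp add: partial_term_def alpha_add add.assoc)
qed

lemma partial_term_append:
  assumes "1 \<le> l" "l \<le> length gs"
  shows "partial_term \<alpha> \<beta> (gs @ hs) l = partial_term \<alpha> \<beta> gs l"
  using assms
  by (induction l rule: dec_induct) (auto simp: partial_term_one partial_term_Suc nth_append)

text \<open>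
  The end points of a connection lie in \<open>S\<close> automatically, which removes the case distinction on the
  length and lets the condition on the partial terms range over all of them.
\<close>
lemma is_connection_iff:
  assumes "g' \<in> S"
  shows "is_connection \<alpha> \<beta> S gs g g' \<longleftrightarrow>
    gs \<noteq> [] \<and> set gs \<subseteq> S \<and> gs ! 0 \<in> orbit \<alpha> \<beta> g \<and>
    (\<forall>l. 1 \<le> l \<and> l \<le> length gs \<longrightarrow> partial_term \<alpha> \<beta> gs l \<in> S) \<and>
    partial_term \<alpha> \<beta> gs (length gs) \<in> pm_orbit \<alpha> \<beta> g'" (is "_ \<longleftrightarrow> ?R")
proof
  assume L: "is_connection \<alpha> \<beta> S gs g g'"
  then have base: "gs \<noteq> []" "set gs \<subseteq> S" "gs ! 0 \<in> orbit \<alpha> \<beta> g"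
    by (auto simp: is_connection_def split: if_splits)
  have last: "partial_term \<alpha> \<beta> gs (length gs) \<in> pm_orbit \<alpha> \<beta> g'"
    using L by (auto simp: is_connection_def partial_term_one split: if_splits)
  have "partial_term \<alpha> \<beta> gs l \<in> S" if "1 \<le> l" "l \<le> length gs" for l
  proof -
    have first: "gs ! 0 \<in> S" using base by (metis length_greater_0_conv nth_mem subsetD)
    have final: "partial_term \<alpha> \<beta> gs (length gs) \<in> S"
      using last pm_orbit_subset[OF assms] by blast
    show ?thesis
    proof (cases "l = 1 \<or> l = length gs")
      case True
      then show ?thesis using first final by (auto simp: partial_term_one)
    next
      case False
      then have "2 \<le> l" "l \<le> length gs - 1" "length gs \<noteq> 1" using that by linarith+
      then show ?thesis using L by (simp add: is_connection_def)
    qed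
  qed
  with base last show ?R by blast
next
  assume R: ?R
  show "is_connection \<alpha> \<beta> S gs g g'"
    using R by (auto simp: is_connection_def partial_term_one)
qed

lemma walk_imp_partial_terms:
  assumes "walk a b" "a \<in> S"
  shows "\<exists>gs. gs \<noteq> [] \<and> set gs \<subseteq> S \<and> gs ! 0 = a \<and>
    (\<forall>l. 1 \<le> l \<and> l \<le> length gs \<longrightarrow> partial_term \<alpha> \<beta> gs l \<in> S) \<and>
    partial_term \<alpha> \<beta> gs (length gs) = b"
  using assms(1)
proof (induction rule: rtranclp_induct)
  case base
  show ?case
    using assms(2) by (intro exI[of _ "[a]"]) (auto simp: partial_term_one le_Suc_eq)
next
  case (step b c)
  then obtain gs where gs: "gs \<noteq> []" "set gs \<subseteq> S" "gs ! 0 = a"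
    "\<And>l. 1 \<le> l \<Longrightarrow> l \<le> length gs \<Longrightarrow> partial_term \<alpha> \<beta> gs l \<in> S"
    "partial_term \<alpha> \<beta> gs (length gs) = b" by blast
  obtain h where h: "h \<in> S" "c = \<alpha> b + \<beta> h" "c \<in> S"
    using step.hyps(2) by (auto simp: step_def)
  have len: "1 \<le> length gs" using gs(1) by (simp add: Suc_le_eq)
  have last: "partial_term \<alpha> \<beta> (gs @ [h]) (Suc (length gs)) = c"
    using len gs(5) h(2) by (simp add: partial_term_Suc partial_term_append)
  have "partial_term \<alpha> \<beta> (gs @ [h]) l \<in> S" if "1 \<le> l" "l \<le> length (gs @ [h])" for l
    using that gs(4) last h(3) by (cases "l = Suc (length gs)") (auto simp: partial_term_append)
  then show ?case
    using gs(1-3) h(1) last by (intro exI[of _ "gs @ [h]"]) (auto simp: nth_append)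
qed

lemma partial_terms_imp_walk:
  assumes "1 \<le> l" "l \<le> length gs" "set gs \<subseteq> S"
    and "\<And>k. 1 \<le> k \<Longrightarrow> k \<le> length gs \<Longrightarrow> partial_term \<alpha> \<beta> gs k \<in> S"
  shows "walk (gs ! 0) (partial_term \<alpha> \<beta> gs l)"
  using assms(1,2)
proof (induction l rule: dec_induct)
  case base
  then show ?case by (simp add: partial_term_one)
next
  case (step l)
  have "gs ! l \<in> S" using step.prems assms(3) nth_mem[of l gs] by auto
  then have "step (partial_term \<alpha> \<beta> gs l) (partial_term \<alpha> \<beta> gs (Suc l))"
    using step.hyps step.prems assms(4)[of l] assms(4)[of "Suc l"]
    by (auto simp: step_def partial_term_Suc)
  with step show ?case by (meson Suc_leD rtranclp.rtrancl_into_rtrancl)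
qed

lemma connected_to_iff_walk:
  assumes "g \<in> S" "g' \<in> S"
  shows "connected_to \<alpha> \<beta> S g g' \<longleftrightarrow> (\<exists>a\<in>orbit \<alpha> \<beta> g. \<exists>b\<in>pm_orbit \<alpha> \<beta> g'. walk a b)"
proof
  assume "connected_to \<alpha> \<beta> S g g'"
  then obtain gs where gs: "gs \<noteq> []" "set gs \<subseteq> S" "gs ! 0 \<in> orbit \<alpha> \<beta> g"
    "\<And>l. 1 \<le> l \<Longrightarrow> l \<le> length gs \<Longrightarrow> partial_term \<alpha> \<beta> gs l \<in> S"
    "partial_term \<alpha> \<beta> gs (length gs) \<in> pm_orbit \<alpha> \<beta> g'"
    by (auto simp: connected_to_def is_connection_iff[OF assms(2)])
  have "walk (gs ! 0) (partial_term \<alpha> \<beta> gs (length gs))"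
    by (rule partial_terms_imp_walk) (use gs in \<open>auto simp: Suc_le_eq\<close>)
  with gs show "\<exists>a\<in>orbit \<alpha> \<beta> g. \<exists>b\<in>pm_orbit \<alpha> \<beta> g'. walk a b" by blast
next
  assume "\<exists>a\<in>orbit \<alpha> \<beta> g. \<exists>b\<in>pm_orbit \<alpha> \<beta> g'. walk a b"
  then obtain a b where ab: "a \<in> orbit \<alpha> \<beta> g" "b \<in> pm_orbit \<alpha> \<beta> g'" "walk a b" by blast
  have "a \<in> S"
    using ab(1) pm_orbit_subset[OF assms(1)] by (auto simp: pm_orbit_def)
  then show "connected_to \<alpha> \<beta> S g g'"
    using walk_imp_partial_terms[OF ab(3)] ab(1,2)
    unfolding connected_to_def is_connection_iff[OF assms(2)] by metis
qed

section \<open>Connectedness is an equivalence relation\<close>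

lemma connected_refl:
  assumes "g \<in> S"
  shows "connected_to \<alpha> \<beta> S g g"
proof -
  have "g = twist 0 0 g" by simp
  then have "g \<in> orbit \<alpha> \<beta> g" "g \<in> pm_orbit \<alpha> \<beta> g"
    unfolding orbit_iff pm_orbit_iff by blast+
  then show ?thesis using connected_to_iff_walk[OF assms assms] by blast
qed

text \<open>
  A connection has to start in the orbit itself, without a sign.  If the given one ends in minus the
  orbit of \<open>g'\<close>, the reversed walk is negated as a whole; the sign then moves to its other end.
\<close>
lemma connected_sym:
  assumes S: "g \<in> S" "g' \<in> S" and "connected_to \<alpha> \<beta> S g g'"
  shows "connected_to \<alpha> \<beta> S g' g"
proof -
  obtain a b where a: "a \<in> orbit \<alpha> \<beta> g" and b: "b \<in> pm_orbit \<alpha> \<beta> g'" and "walk a b"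
    using assms connected_to_iff_walk by blast
  then obtain n where n: "walk b ((\<alpha> ^^ n) a)" using walk_reverse by blast
  have "(\<alpha> ^^ n) a \<in> pm_orbit \<alpha> \<beta> g"
    using orbit_twist[OF a, of n 0] by (simp add: pm_orbit_def)
  moreover have "b \<in> orbit \<alpha> \<beta> g' \<or> - b \<in> orbit \<alpha> \<beta> g'"
    using b by (simp only: pm_orbit_iff_orbit)
  ultimately show ?thesis
    using n walk_image[OF symmetry_minus n] pm_orbit_minus connected_to_iff_walk[OF S(2,1)]
    by blast
qed

lemma connected_trans:
  assumes S: "g \<in> S" "g' \<in> S" "g'' \<in> S"
    and "connected_to \<alpha> \<beta> S g g'" "connected_to \<alpha> \<beta> S g' g''"
  shows "connected_to \<alpha> \<beta> S g g''"
proof -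
  obtain a b where a: "a \<in> orbit \<alpha> \<beta> g" and b: "b \<in> pm_orbit \<alpha> \<beta> g'" and ab: "walk a b"
    using assms connected_to_iff_walk by blast
  obtain a' c where a': "a' \<in> orbit \<alpha> \<beta> g'" and c: "c \<in> pm_orbit \<alpha> \<beta> g''" and ac: "walk a' c"
    using assms connected_to_iff_walk by blast
  obtain i j where ij: "a' = twist i j g'" using a' orbit_iff by blast
  obtain m n where mn: "b = twist m n g' \<or> b = - twist m n g'" using b pm_orbit_iff by blast
  have first: "walk (twist i j a) (twist i j b)"
    by (rule walk_image[OF symmetry_twist ab])
  have second: "walk (twist m n a') (twist m n c)"
    by (rule walk_image[OF symmetry_twist ac])
  \<comment> \<open>This is the meeting point of the two shifted walks, up to the sign with which \<open>b\<close> arises.\<close>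
  have comm: "twist i j (twist m n g') = twist m n a'"
    by (simp only: ij twist_twist add.commute)
  have "\<exists>d\<in>pm_orbit \<alpha> \<beta> g''. walk (twist i j b) d"
    using mn
  proof
    assume "b = twist m n g'"
    then show ?thesis using second comm pm_orbit_twist[OF c] by metis
  next
    assume "b = - twist m n g'"
    then have "twist i j b = - twist m n a'" using comm twist_minus by simp
    then show ?thesis
      using walk_image[OF symmetry_minus second] pm_orbit_minus[OF pm_orbit_twist[OF c]] by metis
  qed
  then obtain d where "d \<in> pm_orbit \<alpha> \<beta> g''" "walk (twist i j a) d"
    using first by (meson rtranclp_trans)
  then show ?thesis
    using orbit_twist[OF a] connected_to_iff_walk[OF S(1,3)] by blast
qed

lemma equiv_connected:
  "equiv S {(g, g'). g \<in> S \<and> g' \<in> S \<and> connected_to \<alpha> \<beta> S g g'}"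
proof (rule equivI)
  show "{(g, g'). g \<in> S \<and> g' \<in> S \<and> connected_to \<alpha> \<beta> S g g'} \<subseteq> S \<times> S"
    by blast
  show "refl_on S {(g, g'). g \<in> S \<and> g' \<in> S \<and> connected_to \<alpha> \<beta> S g g'}"
    using connected_refl by (auto simp: refl_on_def)
  show "sym {(g, g'). g \<in> S \<and> g' \<in> S \<and> connected_to \<alpha> \<beta> S g g'}"
    using connected_sym by (auto simp: sym_def)
  show "trans {(g, g'). g \<in> S \<and> g' \<in> S \<and> connected_to \<alpha> \<beta> S g g'}"
    using connected_trans unfolding trans_def by blast
qed

end

section \<open>The support of the grading\<close>

text \<open>
  Since \<open>\<psi>\<close> is injective and fixes \<open>0\<close>, a non-zero element of \<open>M\<^sub>g\<close> has a non-zero image, which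
  lies in \<open>M\<^bsub>\<alpha> g\<^esub>\<close>; and \<open>\<alpha> g \<noteq> 0\<close> because \<open>\<alpha>\<close>, too, is injective and fixes \<open>0\<close>.
\<close>
lemma grading_support_closed:
  fixes \<psi> :: "('i, 'r::comm_ring) mat \<Rightarrow> ('i, 'r) mat"
    and \<alpha> :: "'g::ab_group_add \<Rightarrow> 'g"
  assumes "mat_alg_automorphism I \<psi>" "group_automorphism \<alpha>" "\<And>g. mat_submodule I (Mg g)"
    and graded: "\<psi> ` Mg g \<subseteq> Mg (\<alpha> g)"
    and "g \<in> grading_support Mg"
  shows "\<alpha> g \<in> grading_support Mg"
proof -
  have zero: "0 \<in> Mg g" and fin: "Mg g \<subseteq> fin_mats I"
    using assms(3) by (auto simp: mat_submodule_def)
  obtain x where x: "x \<in> Mg g" "x \<noteq> 0"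
    using assms(5) zero by (auto simp: grading_support_def)
  have "\<psi> (0 + 0) = \<psi> 0 + \<psi> 0"
    using assms(1) zero fin unfolding mat_alg_automorphism_def by blast
  then have "\<psi> 0 = 0" by simp
  moreover have "inj_on \<psi> (fin_mats I)"
    using assms(1) by (auto simp: mat_alg_automorphism_def bij_betw_def)
  ultimately have "\<psi> x \<noteq> 0"
    using x zero fin by (metis inj_onD subsetD)
  moreover have "\<psi> x \<in> Mg (\<alpha> g)" using x(1) graded by blast
  ultimately have "Mg (\<alpha> g) \<noteq> {0}" by blast
  moreover have "\<alpha> 0 = 0" "inj \<alpha>"
    using assms(2) unfolding group_automorphism_def
    by (metis add_cancel_right_right, simp add: bij_def)
  then have "\<alpha> g \<noteq> 0"
    using assms(5) by (metis (mono_tags, lifting) grading_support_def injD mem_Collect_eq)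
  ultimately show ?thesis by (simp add: grading_support_def)
qed

theorem theorem3p8:
  fixes I :: "'i set"
    and \<psi> \<phi> :: "('i, 'r::comm_ring) mat \<Rightarrow> ('i, 'r) mat"
    and \<alpha> \<beta> :: "'g::ab_group_add \<Rightarrow> 'g"
    and Mg :: "'g \<Rightarrow> ('i, 'r) mat set"
  assumes "mat_alg_automorphism I \<psi>" and "mat_alg_automorphism I \<phi>"
    and "\<And>A. A \<in> fin_mats I \<Longrightarrow> \<psi> (\<phi> A) = \<phi> (\<psi> A)"
    and "group_automorphism \<alpha>" and "group_automorphism \<beta>"
    and "\<alpha> \<circ> \<beta> = \<beta> \<circ> \<alpha>"
    and "mat_direct_sum I Mg"
    and "\<And>g. \<psi> ` Mg g \<subseteq> Mg (\<alpha> g)"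
    and "\<And>g. \<phi> ` Mg g \<subseteq> Mg (\<beta> g)"
    and "\<And>g g' x y. x \<in> Mg g \<Longrightarrow> y \<in> Mg g' \<Longrightarrow> twisted_mult \<psi> \<phi> x y \<in> Mg (\<alpha> g + \<beta> g')"
    and "\<And>g. g \<in> grading_support Mg \<Longrightarrow> - g \<in> grading_support Mg"
  shows "equiv (grading_support Mg)
           {(g, g'). g \<in> grading_support Mg \<and> g' \<in> grading_support Mg \<and>
                     connected_to \<alpha> \<beta> (grading_support Mg) g g'}"
proof -
  have sub: "mat_submodule I (Mg g)" for g
    using assms(7) by (simp add: mat_direct_sum_def)
  have comm: "\<alpha> (\<beta> x) = \<beta> (\<alpha> x)" for x
    using assms(6) by (metis comp_apply)
  have alpha: "\<alpha> g \<in> grading_support Mg" if "g \<in> grading_support Mg" for g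
    by (rule grading_support_closed[where \<psi> = \<psi> and I = I])
       (use that assms(1,4,8) sub in auto)
  have beta: "\<beta> g \<in> grading_support Mg" if "g \<in> grading_support Mg" for g
    by (rule grading_support_closed[where \<psi> = \<phi> and I = I])
       (use that assms(2,5,9) sub in auto)
  interpret commuting_maps \<alpha> \<beta> "grading_support Mg"
    by unfold_locales
       (use assms(4,5,11) comm alpha beta in \<open>auto simp: group_automorphism_def\<close>)
  show ?thesis by (rule equiv_connected)
qed

end
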